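(* Let $k > 2$ be an integer and let $d_0, \varepsilon > 0$ be real numbers. Then there exist an integer $d > d_0$ and a finite $d$-regular linear $k$-graph $H$ containing two vertices $v_1, v_2 \in V(H)$ such that \begin{itemize} \item $\mathcal{P}_H(\overline{v_1}) > 1 - \frac{1 + \varepsilon}{d^{k - 2}}$, and \item $\mathcal{P}_H(\overline{v_2}) < \frac{1 + \varepsilon}{d+1}$. \end{itemize}
   Context: A $k$-graph is a $k$-uniform hypergraph. It is linear if any two distinct edges share at most one vertex, and $d$-regular if every vertex lies in exactly $d$ edges. A matching is a set of pairwise vertex-disjoint edges; the empty set is a matching. For a finite $k$-graph $H$, let $M$ be a matching chosen uniformly at random from the set of all matchings of $H$. For $v \in V(H)$, $\mathcal{P}_H(\overline{v})$ denotes the probability that $M$ does not cover $v$, i.e. that no edge of $M$ contains $v$. *)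

theory Defs
  imports "HOL-Probability.Probability"
begin

definition finite_kgraph :: "nat \<Rightarrow> 'a set \<Rightarrow> 'a set set \<Rightarrow> bool" where
  "finite_kgraph k V E \<longleftrightarrow> finite V \<and> (\<forall>e\<in>E. e \<subseteq> V \<and> card e = k)"

definition linear_hypergraph :: "'a set set \<Rightarrow> bool" where
  "linear_hypergraph E \<longleftrightarrow> (\<forall>e\<in>E. \<forall>f\<in>E. e \<noteq> f \<longrightarrow> card (e \<inter> f) \<le> 1)"

definition regular_hypergraph :: "nat \<Rightarrow> 'a set \<Rightarrow> 'a set set \<Rightarrow> bool" where
  "regular_hypergraph d V E \<longleftrightarrow> (\<forall>v\<in>V. card {e\<in>E. v \<in> e} = d)"

definition matchings :: "'a set set \<Rightarrow> 'a set set set" where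
  "matchings E = {M. M \<subseteq> E \<and> disjoint M}"

(* Only meaningful for finite E: then matchings E is finite, and it contains {},
   so pmf_of_set is indeed the uniform distribution on it. *)
definition prob_uncovered :: "'a set set \<Rightarrow> 'a \<Rightarrow> real" where
  "prob_uncovered E v =
     measure_pmf.prob (pmf_of_set (matchings E)) {M. \<forall>e\<in>M. v \<notin> e}"

end

theory Submission
  imports Defs
begin

text \<open>
  Take a linear k-graph all of whose vertices have degree d = D + 1 except a root of degree D,
  and let x be the probability that the root is uncovered. Joining a new vertex by c edges to
  the roots of c(k - 1) disjoint copies gives a graph of the same kind whose new root has degree c
  and is uncovered with probability 1/(1 + c x^(k-1)). With c = D this iterates the decreasing map
  f(x) = 1/(1 + D x^(k-1)); its square is increasing, so an orbit that does not start at the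
  fixed point p moves monotonically, and since k > 2 any a > p with f(f(a)) \<le> a satisfies
  a + f(a) \<ge> 1. As f(a) < p is small, the iterates get close to 1. With c = d, the roots built
  from such a and from f(a) are the two required vertices.

  The orbit starts off the fixed point for an arithmetic reason: probabilities are rational,
  and p is irrational when D is a k-th power.
\<close>

section \<open>Counting matchings\<close>

definition vertex_degree :: "'a set set \<Rightarrow> 'a \<Rightarrow> nat" where
  "vertex_degree E v = card {e\<in>E. v \<in> e}"

definition num_matchings :: "'a set set \<Rightarrow> nat" where
  "num_matchings E = card (matchings E)"

lemma finite_matchings: "finite E \<Longrightarrow> finite (matchings E)"
  unfolding matchings_def by (rule finite_subset[of _ "Pow E"]) auto

lemma empty_in_matchings: "{} \<in> matchings E"
  by (simp add: matchings_def disjoint_def)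

lemma matchings_empty: "matchings {} = {{}}"
  by (auto simp: matchings_def)

lemma num_matchings_pos: "finite E \<Longrightarrow> num_matchings E > 0"
  unfolding num_matchings_def using finite_matchings empty_in_matchings
  by (metis card_gt_0_iff empty_iff)

text \<open>A matching that leaves \<open>v\<close> uncovered is the same as a matching of the edges
  avoiding \<open>v\<close>, so the probability is a ratio of two counts. The later product formulas
  start from this ratio, and so does the rationality of the probabilities.\<close>

lemma prob_uncovered_eq:
  assumes "finite E"
  shows "prob_uncovered E v = num_matchings {e\<in>E. v \<notin> e} / num_matchings E"
proof -
  have "prob_uncovered E v = card (matchings E \<inter> {M. \<forall>e\<in>M. v \<notin> e}) / card (matchings E)"
    unfolding prob_uncovered_def
    using empty_in_matchings finite_matchings[OF assms]
    by (subst measure_pmf_of_set) auto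
  also have "matchings E \<inter> {M. \<forall>e\<in>M. v \<notin> e} = matchings {e\<in>E. v \<notin> e}"
    by (auto simp: matchings_def)
  finally show ?thesis by (simp add: num_matchings_def)
qed

lemma prob_uncovered_pos: "finite E \<Longrightarrow> prob_uncovered E v > 0"
  by (simp add: prob_uncovered_eq num_matchings_pos)

lemma matchings_mono: "M \<in> matchings E \<Longrightarrow> N \<subseteq> M \<Longrightarrow> N \<subseteq> F \<Longrightarrow> N \<in> matchings F"
  by (simp add: matchings_def disjoint_def subset_iff)

text \<open>A matching of the union splits uniquely into its parts in \<open>A\<close> and in
  \<open>B\<close>, and any two such parts are compatible. An edge in both families would be
  disjoint from itself, hence empty, which \<open>{} \<notin> A\<close> rules out.\<close>

lemma num_matchings_Un:
  assumes "finite A" "finite B" and disj: "\<And>a b. a \<in> A \<Longrightarrow> b \<in> B \<Longrightarrow> a \<inter> b = {}"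
    and "{} \<notin> A"
  shows "num_matchings (A \<union> B) = num_matchings A * num_matchings B"
proof -
  have AB: "A \<inter> B = {}"
    using disj assms(4) by fastforce
  have "bij_betw (\<lambda>(M, N). M \<union> N) (matchings A \<times> matchings B) (matchings (A \<union> B))"
  proof (rule bij_betw_byWitness[where f' = "\<lambda>M. (M \<inter> A, M \<inter> B)"])
    show "\<forall>a\<in>matchings A \<times> matchings B. (\<lambda>M. (M \<inter> A, M \<inter> B)) (case a of (M, N) \<Rightarrow> M \<union> N) = a"
      using AB by (auto simp: matchings_def)
    show "(\<lambda>(M, N). M \<union> N) ` (matchings A \<times> matchings B) \<subseteq> matchings (A \<union> B)"
    proof clarify
      fix M N assume M: "M \<in> matchings A" "N \<in> matchings B"
      then have sub: "M \<subseteq> A" "N \<subseteq> B" by (auto simp: matchings_def)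
      then have "\<Union>M \<inter> \<Union>N = {}"
        using disj by (meson Int_emptyI UnionE disjoint_iff subsetD)
      with M have "disjoint (M \<union> N)"
        by (intro disjoint_union) (simp_all add: matchings_def)
      with sub show "M \<union> N \<in> matchings (A \<union> B)"
        by (auto simp: matchings_def)
    qed
    show "\<forall>M\<in>matchings (A \<union> B). (case (M \<inter> A, M \<inter> B) of (M, N) \<Rightarrow> M \<union> N) = M"
      by (auto simp: matchings_def)
    show "(\<lambda>M. (M \<inter> A, M \<inter> B)) ` matchings (A \<union> B) \<subseteq> matchings A \<times> matchings B"
      by (auto intro: matchings_mono)
  qed
  then show ?thesis
    unfolding num_matchings_def by (metis bij_betw_same_card card_cartesian_product)
qed

lemma num_matchings_image:
  assumes "inj_on f (\<Union>E)"
  shows "num_matchings ((`) f ` E) = num_matchings E"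
proof -
  have inj: "inj_on ((`) f) E"
    using assms by (meson inj_on_image)
  have int: "f ` a \<inter> f ` b = {} \<longleftrightarrow> a \<inter> b = {}" if "a \<in> E" "b \<in> E" for a b
    using inj_on_image_Int[OF assms, of a b] that by (metis Sup_upper image_is_empty)
  have disj: "disjoint ((`) f ` M) \<longleftrightarrow> disjoint M" if "M \<subseteq> E" for M
  proof -
    have "a \<inter> b = {} \<longleftrightarrow> f ` a \<inter> f ` b = {}" "f ` a = f ` b \<longleftrightarrow> a = b" if "a \<in> M" "b \<in> M" for a b
      using that \<open>M \<subseteq> E\<close> int inj by (blast, metis inj_on_def subsetD)
    then show ?thesis
      unfolding disjoint_def by simp
  qed
  have "matchings ((`) f ` E) = (`) ((`) f) ` matchings E"
    unfolding matchings_def using disj by (auto simp: subset_image_iff)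
  moreover have "inj_on ((`) ((`) f)) (matchings E)"
    using inj by (rule inj_on_subset[OF inj_on_image_Pow]) (auto simp: matchings_def)
  ultimately show ?thesis
    by (simp add: num_matchings_def card_image)
qed

text \<open>At most one edge \<open>e\<close> of a matching contains \<open>v\<close>, and removing
  it leaves a matching of the edges disjoint from \<open>e\<close>. This is the usual recurrence for
  counting matchings, here for hyperedges.\<close>

lemma num_matchings_vertex:
  assumes "finite E"
  shows "num_matchings E = num_matchings {e\<in>E. v \<notin> e} +
    (\<Sum>e\<in>{e\<in>E. v \<in> e}. num_matchings {f\<in>E. f \<inter> e = {}})"
proof -
  let ?R = "{e\<in>E. v \<in> e}"
  let ?F = "\<lambda>e. insert e ` matchings {f\<in>E. f \<inter> e = {}}"
  have eq: "matchings E = matchings {e\<in>E. v \<notin> e} \<union> (\<Union>e\<in>?R. ?F e)"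
  proof (intro equalityI subsetI)
    fix M assume M: "M \<in> matchings E"
    show "M \<in> matchings {e\<in>E. v \<notin> e} \<union> (\<Union>e\<in>?R. ?F e)"
    proof (cases "\<exists>e\<in>M. v \<in> e")
      case True
      then obtain e where e: "e \<in> M" "v \<in> e" by blast
      have "f \<inter> e = {}" "f \<in> E" if "f \<in> M - {e}" for f
        using M e that unfolding matchings_def by (auto dest: disjointD)
      then have "M - {e} \<in> matchings {f\<in>E. f \<inter> e = {}}"
        by (intro matchings_mono[OF M]) auto
      moreover have "M = insert e (M - {e})" using e by blast
      ultimately have "M \<in> ?F e" by (rule rev_image_eqI)
      moreover have "e \<in> ?R" using e M by (auto simp: matchings_def)
      ultimately show ?thesis by blast
    qed (use M in \<open>auto simp: matchings_def\<close>)
  next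
    fix M assume "M \<in> matchings {e\<in>E. v \<notin> e} \<union> (\<Union>e\<in>?R. ?F e)"
    then consider "M \<in> matchings {e\<in>E. v \<notin> e}" | e N where "e \<in> ?R" "M = insert e N"
      "N \<in> matchings {f\<in>E. f \<inter> e = {}}" by blast
    then show "M \<in> matchings E"
    proof cases
      case 2
      then have N: "N \<subseteq> {f\<in>E. f \<inter> e = {}}" "disjoint N" by (auto simp: matchings_def)
      then have "\<forall>f\<in>N. f \<inter> e = {} \<and> e \<inter> f = {}" by blast
      with 2 N show ?thesis unfolding matchings_def disjoint_def by auto
    qed (auto simp: matchings_def)
  qed
  have fin: "finite (?F e)" for e
    using assms by (simp add: finite_matchings)
  have "card (matchings E) = card (matchings {e\<in>E. v \<notin> e}) + card (\<Union>e\<in>?R. ?F e)"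
    unfolding eq using assms fin by (subst card_Un_disjoint) (auto simp: finite_matchings matchings_def)
  also have "card (\<Union>e\<in>?R. ?F e) = (\<Sum>e\<in>?R. card (?F e))"
  proof (rule card_UN_disjoint)
    \<comment> \<open>Distinct edges \<open>i\<close> and \<open>j\<close> at \<open>v\<close>
      intersect, so a matching that contains \<open>i\<close> cannot contain
      \<open>j\<close>.\<close>
    show "\<forall>i\<in>?R. \<forall>j\<in>?R. i \<noteq> j \<longrightarrow> ?F i \<inter> ?F j = {}"
    proof (intro ballI impI)
      fix i j assume ij: "i \<in> ?R" "j \<in> ?R" "i \<noteq> j"
      have "i \<inter> j \<noteq> {}" using ij by blast
      then have "j \<notin> M" if "M \<in> ?F i" for M
        using that ij by (auto simp: matchings_def)
      moreover have "j \<in> M" if "M \<in> ?F j" for M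
        using that by (elim imageE) simp
      ultimately show "?F i \<inter> ?F j = {}" by (intro Int_emptyI) metis
    qed
  qed (use assms fin in simp_all)
  also have "\<dots> = (\<Sum>e\<in>?R. num_matchings {f\<in>E. f \<inter> e = {}})"
  proof (rule sum.cong)
    fix e assume "e \<in> ?R"
    then have "e \<notin> M" if "M \<in> matchings {f\<in>E. f \<inter> e = {}}" for M
      using that by (auto simp: matchings_def)
    then have "inj_on (insert e) (matchings {f\<in>E. f \<inter> e = {}})"
      by (intro inj_onI) (metis insert_ident)
    then show "card (?F e) = num_matchings {f\<in>E. f \<inter> e = {}}"
      by (simp add: card_image num_matchings_def)
  qed simp
  finally show ?thesis by (simp add: num_matchings_def)
qed

section \<open>Disjoint sums with additional edges\<close>

text \<open>Tagging vertices with an index makes the summands disjoint, at the price of a new vertex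
  type. Letting \<open>E\<close> depend on the index allows an edgeless summand beside copies of a
  fixed graph.\<close>

definition sum_edges :: "'i set \<Rightarrow> ('i \<Rightarrow> 'a set set) \<Rightarrow> ('i \<times> 'a) set set" where
  "sum_edges I E = (\<Union>i\<in>I. (\<lambda>e. {i} \<times> e) ` E i)"

lemma finite_sum_edges: "finite I \<Longrightarrow> (\<And>i. i \<in> I \<Longrightarrow> finite (E i)) \<Longrightarrow> finite (sum_edges I E)"
  by (simp add: sum_edges_def)

lemma filter_sum_edges: "{e\<in>sum_edges I E. P e} = sum_edges I (\<lambda>i. {e\<in>E i. P ({i} \<times> e)})"
  unfolding sum_edges_def by blast

lemma sum_edges_cong: "(\<And>i. i \<in> I \<Longrightarrow> E i = F i) \<Longrightarrow> sum_edges I E = sum_edges I F"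
  by (simp add: sum_edges_def)

lemma num_matchings_sum_edges:
  assumes "finite I" and "\<And>i. i \<in> I \<Longrightarrow> finite (E i)" and "\<And>i. i \<in> I \<Longrightarrow> {} \<notin> E i"
  shows "num_matchings (sum_edges I E) = (\<Prod>i\<in>I. num_matchings (E i))"
  using assms
proof (induction I rule: finite_induct)
  case empty
  show ?case by (simp add: sum_edges_def num_matchings_def matchings_empty)
next
  case (insert i I)
  have img: "(\<lambda>e. {i} \<times> e) ` E i = (`) (Pair i) ` E i"
    by (intro image_cong) auto
  have "num_matchings (sum_edges (insert i I) E) =
    num_matchings ((\<lambda>e. {i} \<times> e) ` E i \<union> sum_edges I E)"
    by (simp add: sum_edges_def)
  also have "\<dots> = num_matchings ((\<lambda>e. {i} \<times> e) ` E i) * num_matchings (sum_edges I E)"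
  proof (rule num_matchings_Un)
    show "{} \<notin> (\<lambda>e. {i} \<times> e) ` E i"
    proof
      assume "{} \<in> (\<lambda>e. {i} \<times> e) ` E i"
      then obtain e where "e \<in> E i" "{} = {i} \<times> e" by (elim imageE)
      with insert.prems(2)[of i] show False by (metis Times_empty insertI1 insert_not_empty)
    qed
    show "a \<inter> b = {}" if ab: "a \<in> (\<lambda>e. {i} \<times> e) ` E i" "b \<in> sum_edges I E" for a b
    proof -
      obtain e j e' where "a = {i} \<times> e" "j \<in> I" "b = {j} \<times> e'"
        using ab unfolding sum_edges_def by blast
      then show ?thesis using insert.hyps by auto
    qed
  qed (use insert in \<open>auto simp: finite_sum_edges\<close>)
  also have "num_matchings ((\<lambda>e. {i} \<times> e) ` E i) = num_matchings (E i)"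
    unfolding img by (rule num_matchings_image) (simp add: inj_on_def)
  finally show ?case using insert by simp
qed

lemma finite_kgraph_sum_edges:
  assumes "finite I" "\<And>i. i \<in> I \<Longrightarrow> finite_kgraph k (V i) (E i)"
  shows "finite_kgraph k (Sigma I V) (sum_edges I E)"
  unfolding finite_kgraph_def
proof (intro conjI ballI)
  show "finite (Sigma I V)" using assms by (auto simp: finite_kgraph_def)
next
  fix e assume "e \<in> sum_edges I E"
  then obtain i e' where i: "i \<in> I" "e' \<in> E i" "e = {i} \<times> e'" by (unfold sum_edges_def, blast)
  then have "e' \<subseteq> V i" "card e' = k" using assms by (auto simp: finite_kgraph_def)
  with i show "e \<subseteq> Sigma I V" "card e = k" by (auto simp: card_cartesian_product)
qed

lemma linear_sum_edges:
  assumes "\<And>i. i \<in> I \<Longrightarrow> linear_hypergraph (E i)"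
  shows "linear_hypergraph (sum_edges I E)"
  unfolding linear_hypergraph_def
proof (intro ballI impI)
  fix e f assume "e \<in> sum_edges I E" "f \<in> sum_edges I E" "e \<noteq> f"
  then obtain i j e' f' where ef: "i \<in> I" "e' \<in> E i" "e = {i} \<times> e'" "j \<in> I" "f' \<in> E j" "f = {j} \<times> f'"
    unfolding sum_edges_def by blast
  show "card (e \<inter> f) \<le> 1"
  proof (cases "i = j")
    case True
    then have "e \<inter> f = {i} \<times> (e' \<inter> f')" using ef by auto
    moreover have "card (e' \<inter> f') \<le> 1"
      using assms ef True \<open>e \<noteq> f\<close> by (auto simp: linear_hypergraph_def)
    ultimately show ?thesis by (simp add: card_cartesian_product)
  next
    case False
    then have "e \<inter> f = {}" using ef by auto
    then show ?thesis by simp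
  qed
qed

lemma vertex_degree_sum_edges:
  assumes "i \<in> I"
  shows "vertex_degree (sum_edges I E) (i, v) = vertex_degree (E i) v"
proof -
  have "{e \<in> sum_edges I E. (i, v) \<in> e} = (\<lambda>e. {i} \<times> e) ` {e\<in>E i. v \<in> e}"
    (is "?L = ?R")
  proof (intro equalityI subsetI)
    fix x assume "x \<in> ?L"
    then obtain j e where "j \<in> I" "e \<in> E j" "x = {j} \<times> e" "(i, v) \<in> x"
      unfolding sum_edges_def by blast
    then have "e \<in> {e\<in>E i. v \<in> e}" "x = {i} \<times> e" by auto
    then show "x \<in> ?R" by blast
  next
    fix x assume "x \<in> ?R"
    then obtain e where "e \<in> E i" "v \<in> e" "x = {i} \<times> e" by blast
    with assms show "x \<in> ?L" unfolding sum_edges_def by blast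
  qed
  moreover have "inj_on (\<lambda>e. {i} \<times> e) {e\<in>E i. v \<in> e}" by (auto simp: inj_on_def)
  ultimately show ?thesis
    by (simp add: vertex_degree_def card_image)
qed

text \<open>Both counts in the ratio factor over the summands; the factors of all summands other
  than \<open>j\<close> agree, are positive and cancel.\<close>

lemma prob_uncovered_sum_edges:
  assumes "finite I" and "\<And>i. i \<in> I \<Longrightarrow> finite (E i)" and "\<And>i. i \<in> I \<Longrightarrow> {} \<notin> E i" and "j \<in> I"
  shows "prob_uncovered (sum_edges I E) (j, v) = prob_uncovered (E j) v"
proof -
  let ?F = "\<lambda>i. if i = j then {e\<in>E j. v \<notin> e} else E i"
  have "{e\<in>sum_edges I E. (j, v) \<notin> e} = sum_edges I ?F"
    unfolding filter_sum_edges by (rule sum_edges_cong) auto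
  moreover have "num_matchings (sum_edges I ?F) = (\<Prod>i\<in>I. num_matchings (?F i))"
    using assms by (intro num_matchings_sum_edges) auto
  moreover have "(\<Prod>i\<in>I. num_matchings (?F i)) =
      num_matchings {e\<in>E j. v \<notin> e} * (\<Prod>i\<in>I-{j}. num_matchings (E i))"
    using assms by (subst prod.remove[of _ j]) auto
  moreover have "num_matchings (sum_edges I E) = num_matchings (E j) * (\<Prod>i\<in>I-{j}. num_matchings (E i))"
    using assms by (subst num_matchings_sum_edges) (auto intro: prod.remove)
  moreover have "(\<Prod>i\<in>I-{j}. num_matchings (E i)) > 0"
    using assms by (intro prod_pos) (auto intro: num_matchings_pos)
  ultimately show ?thesis
    using assms by (simp add: prob_uncovered_eq finite_sum_edges)
qed

section \<open>Unions of edge sets and injective relabelling of vertices\<close>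

lemma linear_hypergraph_Un:
  assumes "linear_hypergraph A" "linear_hypergraph B"
    and "\<And>a b. a \<in> A \<Longrightarrow> b \<in> B \<Longrightarrow> card (a \<inter> b) \<le> 1"
  shows "linear_hypergraph (A \<union> B)"
  using assms unfolding linear_hypergraph_def by (metis Int_commute Un_iff)

lemma vertex_degree_Un:
  assumes "finite A" "finite B" "A \<inter> B = {}"
  shows "vertex_degree (A \<union> B) v = vertex_degree A v + vertex_degree B v"
proof -
  have "{e \<in> A \<union> B. v \<in> e} = {e\<in>A. v \<in> e} \<union> {e\<in>B. v \<in> e}" by blast
  then show ?thesis
    unfolding vertex_degree_def using assms by (simp, subst card_Un_disjoint) auto
qed

lemma finite_kgraph_finite: "finite_kgraph k V E \<Longrightarrow> finite E"
  unfolding finite_kgraph_def by (meson PowI finite_Pow_iff finite_subset subsetI)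

lemma finite_kgraph_nonempty: "finite_kgraph k V E \<Longrightarrow> k > 0 \<Longrightarrow> {} \<notin> E"
  unfolding finite_kgraph_def by auto

lemma finite_kgraph_image:
  assumes "inj f" "finite_kgraph k V E"
  shows "finite_kgraph k (f ` V) ((`) f ` E)"
  using assms by (auto simp: finite_kgraph_def card_image inj_on_subset)

lemma linear_hypergraph_image:
  assumes "inj f" "linear_hypergraph E"
  shows "linear_hypergraph ((`) f ` E)"
  using assms unfolding linear_hypergraph_def
  by (simp flip: image_Int add: card_image inj_on_subset[OF assms(1)]) metis

lemma vertex_degree_image:
  assumes "inj f"
  shows "vertex_degree ((`) f ` E) (f v) = vertex_degree E v"
proof -
  have "{e \<in> (`) f ` E. f v \<in> e} = (`) f ` {e\<in>E. v \<in> e}"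
    using inj_image_mem_iff[OF assms(1)] by blast
  moreover have "inj_on ((`) f) {e\<in>E. v \<in> e}"
    using assms by (auto simp: inj_on_def inj_image_eq_iff)
  ultimately show ?thesis
    by (simp add: vertex_degree_def card_image)
qed

lemma prob_uncovered_image:
  assumes "inj f" "finite E"
  shows "prob_uncovered ((`) f ` E) (f v) = prob_uncovered E v"
proof -
  have "{e \<in> (`) f ` E. f v \<notin> e} = (`) f ` {e\<in>E. v \<notin> e}"
    using inj_image_mem_iff[OF assms(1)] by blast
  then show ?thesis
    using assms by (simp add: prob_uncovered_eq num_matchings_image inj_on_subset)
qed

section \<open>Rooted linear k-graphs\<close>

text \<open>The root degree \<open>c\<close> is kept apart from the common degree \<open>d\<close>:
  for \<open>d = Suc c\<close> the root has room for exactly one further edge, and for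
  \<open>c = d\<close> this is a regular graph with a marked vertex.\<close>

definition rooted_kgraph :: "nat \<Rightarrow> nat \<Rightarrow> nat \<Rightarrow> 'a set \<Rightarrow> 'a set set \<Rightarrow> 'a \<Rightarrow> bool" where
  "rooted_kgraph k d c V E r \<longleftrightarrow> finite_kgraph k V E \<and> linear_hypergraph E \<and> r \<in> V \<and>
     vertex_degree E r = c \<and> (\<forall>v\<in>V - {r}. vertex_degree E v = d)"

text \<open>Sums change the vertex type, so every construction ends by relabelling with natural
  numbers. Only then can it be iterated.\<close>

lemma rooted_kgraph_to_nat:
  fixes V :: "'a::countable set"
  assumes "rooted_kgraph k d c V E r"
  shows "\<exists>(V'::nat set) E' r'. rooted_kgraph k d c V' E' r' \<and> prob_uncovered E' r' = prob_uncovered E r"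
proof (intro exI conjI)
  let ?f = "to_nat :: 'a \<Rightarrow> nat"
  show "rooted_kgraph k d c (?f ` V) ((`) ?f ` E) (?f r)"
    using assms unfolding rooted_kgraph_def
    by (auto simp: finite_kgraph_image linear_hypergraph_image vertex_degree_image)
  show "prob_uncovered ((`) ?f ` E) (?f r) = prob_uncovered E r"
    using assms by (intro prob_uncovered_image) (auto simp: rooted_kgraph_def finite_kgraph_finite)
qed

text \<open>The bound \<open>cross\<close> also keeps the two edge sets disjoint: a common edge
  would meet itself in \<open>k > 1\<close> vertices. Hence degrees add.\<close>

lemma glue_kgraphs:
  assumes "k > 1" and A: "finite_kgraph k V A" "linear_hypergraph A"
    and B: "finite_kgraph k V B" "linear_hypergraph B"
    and cross: "\<And>a b. a \<in> A \<Longrightarrow> b \<in> B \<Longrightarrow> card (a \<inter> b) \<le> 1"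
  shows "finite_kgraph k V (A \<union> B)" "linear_hypergraph (A \<union> B)"
    "vertex_degree (A \<union> B) v = vertex_degree A v + vertex_degree B v"
proof -
  show "finite_kgraph k V (A \<union> B)" using A B by (auto simp: finite_kgraph_def)
  show "linear_hypergraph (A \<union> B)" using A B cross by (intro linear_hypergraph_Un)
  have "A \<inter> B = {}"
  proof (intro Int_emptyI)
    fix e assume "e \<in> A" "e \<in> B"
    with cross[of e e] have "card e \<le> 1" by simp
    moreover have "card e = k" using \<open>e \<in> A\<close> A by (simp add: finite_kgraph_def)
    ultimately show False using \<open>k > 1\<close> by simp
  qed
  then show "vertex_degree (A \<union> B) v = vertex_degree A v + vertex_degree B v"
    using A B by (intro vertex_degree_Un) (auto simp: finite_kgraph_finite)
qed

text \<open>A pair (J, u) stands for the edge joining the copies of vertex u in the summands J.\<close>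
definition cross_edges :: "('i set \<times> 'a) set \<Rightarrow> ('i \<times> 'a) set set" where
  "cross_edges Q = (\<lambda>(J, u). J \<times> {u}) ` Q"

lemma cross_edgesE:
  assumes "f \<in> cross_edges Q"
  obtains J u where "(J, u) \<in> Q" "f = J \<times> {u}"
  using assms by (auto simp: cross_edges_def)

lemma vertex_degree_cross_edges:
  "vertex_degree (cross_edges Q) (i, v) = card {J. (J, v) \<in> Q \<and> i \<in> J}"
proof -
  have "{f \<in> cross_edges Q. (i, v) \<in> f} = (\<lambda>J. J \<times> {v}) ` {J. (J, v) \<in> Q \<and> i \<in> J}"
    (is "?L = ?R")
  proof (intro equalityI subsetI)
    fix f assume f: "f \<in> ?L"
    then have "f \<in> cross_edges Q" by simp
    then obtain J u where J: "(J, u) \<in> Q" "f = J \<times> {u}" by (rule cross_edgesE)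
    with f have "u = v" "i \<in> J" by auto
    with J show "f \<in> ?R" by blast
  next
    fix f assume "f \<in> ?R"
    then obtain J where J: "(J, v) \<in> Q" "i \<in> J" "f = J \<times> {v}" by blast
    then have "f \<in> cross_edges Q" by (force simp: cross_edges_def)
    with J show "f \<in> ?L" by simp
  qed
  moreover have "inj_on (\<lambda>J. J \<times> {v}) {J. (J, v) \<in> Q \<and> i \<in> J}" by (auto simp: inj_on_def)
  ultimately show ?thesis by (simp add: vertex_degree_def card_image)
qed

text \<open>Edges of a summand are constant in the first coordinate and cross edges in the second,
  so one of each share at most one vertex. Cross edges at different \<open>u\<close> are disjoint,
  which reduces linearity to the index sets belonging to one \<open>u\<close>.\<close>

lemma sum_Un_cross_edges:
  assumes k: "k > 1" and I: "finite I"
    and E: "\<And>i. i \<in> I \<Longrightarrow> finite_kgraph k (V i) (E i)" "\<And>i. i \<in> I \<Longrightarrow> linear_hypergraph (E i)"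
    and Q: "\<And>J u. (J, u) \<in> Q \<Longrightarrow> J \<subseteq> I \<and> card J = k \<and> (\<forall>i\<in>J. u \<in> V i)"
    and lin: "\<And>J J' u. (J, u) \<in> Q \<Longrightarrow> (J', u) \<in> Q \<Longrightarrow> J \<noteq> J' \<Longrightarrow> card (J \<inter> J') \<le> 1"
  shows "finite_kgraph k (Sigma I V) (sum_edges I E \<union> cross_edges Q)"
    and "linear_hypergraph (sum_edges I E \<union> cross_edges Q)"
    and "i \<in> I \<Longrightarrow> vertex_degree (sum_edges I E \<union> cross_edges Q) (i, v) =
           vertex_degree (E i) v + card {J. (J, v) \<in> Q \<and> i \<in> J}"
proof -
  have 1: "finite_kgraph k (Sigma I V) (sum_edges I E)"
    using I E(1) by (rule finite_kgraph_sum_edges)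
  have 2: "linear_hypergraph (sum_edges I E)"
    using E(2) by (rule linear_sum_edges)
  have 3: "finite_kgraph k (Sigma I V) (cross_edges Q)"
    unfolding finite_kgraph_def
  proof (intro conjI ballI)
    show "finite (Sigma I V)" using I E by (auto simp: finite_kgraph_def)
    fix f assume "f \<in> cross_edges Q"
    then obtain J u where J: "(J, u) \<in> Q" "f = J \<times> {u}" by (rule cross_edgesE)
    from Q[OF J(1)] J(2) show "f \<subseteq> Sigma I V" "card f = k"
      by (auto simp: card_cartesian_product)
  qed
  have 4: "linear_hypergraph (cross_edges Q)"
    unfolding linear_hypergraph_def
  proof (intro ballI impI)
    fix e f assume e: "e \<in> cross_edges Q" and f: "f \<in> cross_edges Q" and "e \<noteq> f"
    from e obtain J u where J: "(J, u) \<in> Q" "e = J \<times> {u}" by (rule cross_edgesE)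
    from f obtain J' u' where J': "(J', u') \<in> Q" "f = J' \<times> {u'}" by (rule cross_edgesE)
    show "card (e \<inter> f) \<le> 1"
    proof (cases "u = u'")
      case True
      then have "e \<inter> f = (J \<inter> J') \<times> {u}" using J J' by auto
      moreover have "card (J \<inter> J') \<le> 1" using lin J J' True \<open>e \<noteq> f\<close> by blast
      ultimately show ?thesis by (simp add: card_cartesian_product)
    next
      case False
      then have "e \<inter> f = {}" using J J' by auto
      then show ?thesis by simp
    qed
  qed
  have 5: "card (e \<inter> f) \<le> 1" if e: "e \<in> sum_edges I E" and f: "f \<in> cross_edges Q" for e f
  proof -
    from e obtain i e' where i: "e = {i} \<times> e'" unfolding sum_edges_def by blast
    from f obtain J u where J: "(J, u) \<in> Q" "f = J \<times> {u}" by (rule cross_edgesE)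
    have "e \<inter> f \<subseteq> {(i, u)}" using i J by auto
    then show ?thesis using card_mono[of "{(i, u)}"] by simp
  qed
  note glue = glue_kgraphs[OF k 1 2 3 4 5]
  show "finite_kgraph k (Sigma I V) (sum_edges I E \<union> cross_edges Q)"
    "linear_hypergraph (sum_edges I E \<union> cross_edges Q)"
    by (rule glue; assumption)+
  show "vertex_degree (sum_edges I E \<union> cross_edges Q) (i, v) =
      vertex_degree (E i) v + card {J. (J, v) \<in> Q \<and> i \<in> J}" if "i \<in> I"
    using that by (subst glue(3)) (simp_all add: vertex_degree_sum_edges vertex_degree_cross_edges)
qed

text \<open>All cross edges contain the root \<open>(z, r)\<close>, which is isolated in the sum, so
  a matching uses at most one of them. If it uses the one on \<open>J\<close>, the copies of
  \<open>r\<close> in the other summands of \<open>J\<close> must be left uncovered, and these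
  events are independent. Dividing all counts by the number of matchings of the sum gives the
  formula.\<close>

lemma prob_uncovered_cross_edges:
  assumes I: "finite I" "z \<in> I" and E: "\<And>i. i \<in> I \<Longrightarrow> finite (E i)" "\<And>i. i \<in> I \<Longrightarrow> {} \<notin> E i"
    and z: "E z = {}" and J: "\<And>J. J \<in> \<J> \<Longrightarrow> z \<in> J \<and> J \<subseteq> I" "finite \<J>"
  shows "prob_uncovered (sum_edges I E \<union> cross_edges (\<J> \<times> {r})) (z, r) =
    1 / (1 + (\<Sum>J\<in>\<J>. \<Prod>i\<in>J - {z}. prob_uncovered (E i) r))"
proof -
  let ?S = "sum_edges I E" and ?R = "cross_edges (\<J> \<times> {r})"
  have R_eq: "?R = (\<lambda>J. J \<times> {r}) ` \<J>" by (force simp: cross_edges_def)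
  have finS: "finite ?S" using I E by (intro finite_sum_edges)
  have finE: "finite (?S \<union> ?R)" using finS J by (simp add: R_eq)
  have S_o: "(z, r) \<notin> e" if "e \<in> ?S" for e
    using that z unfolding sum_edges_def by auto
  have R_o: "(z, r) \<in> f" if "f \<in> ?R" for f
    using that J(1) unfolding R_eq by auto
  have off: "{e \<in> ?S \<union> ?R. (z, r) \<notin> e} = ?S" and on: "{e \<in> ?S \<union> ?R. (z, r) \<in> e} = ?R"
    using S_o R_o by auto
  have ZS: "num_matchings ?S = (\<Prod>i\<in>I. num_matchings (E i))"
    using I E by (intro num_matchings_sum_edges)
  have edge_term: "real (num_matchings {f \<in> ?S \<union> ?R. f \<inter> J \<times> {r} = {}}) =
      num_matchings ?S * (\<Prod>i\<in>J - {z}. prob_uncovered (E i) r)" if "J \<in> \<J>" for J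
  proof -
    \<comment> \<open>Once the edge on \<open>J\<close> is chosen, every other cross edge is blocked
      at \<open>(z, r)\<close>, and each summand in \<open>J\<close> loses its edges at
      \<open>r\<close>; the summand \<open>z\<close> has none to lose.\<close>
    let ?F = "\<lambda>i. if i \<in> J - {z} then {e \<in> E i. r \<notin> e} else E i"
    have "f \<inter> J \<times> {r} \<noteq> {}" if "f \<in> ?R" for f
      using R_o[OF that] J(1)[OF \<open>J \<in> \<J>\<close>] by auto
    then have "{f \<in> ?S \<union> ?R. f \<inter> J \<times> {r} = {}} = {f \<in> ?S. f \<inter> J \<times> {r} = {}}" by blast
    also have "\<dots> = sum_edges I ?F"
      unfolding filter_sum_edges using z by (intro sum_edges_cong) auto
    finally have "num_matchings {f \<in> ?S \<union> ?R. f \<inter> J \<times> {r} = {}} = (\<Prod>i\<in>I. num_matchings (?F i))"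
      using num_matchings_sum_edges[of I ?F] I E by simp
    then have "real (num_matchings {f \<in> ?S \<union> ?R. f \<inter> J \<times> {r} = {}}) =
        (\<Prod>i\<in>I. real (num_matchings (?F i)))" by simp
    also have "\<dots> = (\<Prod>i\<in>I. real (num_matchings (E i)) *
        (if i \<in> J - {z} then prob_uncovered (E i) r else 1))"
      using E num_matchings_pos[OF E(1)] by (intro prod.cong) (auto simp: prob_uncovered_eq)
    also have "\<dots> = num_matchings ?S * (\<Prod>i\<in>I. if i \<in> J - {z} then prob_uncovered (E i) r else 1)"
      by (simp add: prod.distrib ZS)
    also have "(\<Prod>i\<in>I. if i \<in> J - {z} then prob_uncovered (E i) r else 1) =
        (\<Prod>i\<in>I \<inter> (J - {z}). prob_uncovered (E i) r)"
      using I by (intro prod.inter_restrict[symmetric])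
    also have "I \<inter> (J - {z}) = J - {z}" using J(1) that by blast
    finally show ?thesis .
  qed
  have inj: "inj_on (\<lambda>J. J \<times> {r}) \<J>" by (auto simp: inj_on_def)
  have "real (num_matchings (?S \<union> ?R)) = num_matchings ?S +
      (\<Sum>e\<in>?R. real (num_matchings {f \<in> ?S \<union> ?R. f \<inter> e = {}}))"
    using num_matchings_vertex[OF finE, of "(z, r)"] unfolding off on by simp
  also have "(\<Sum>e\<in>?R. real (num_matchings {f \<in> ?S \<union> ?R. f \<inter> e = {}})) =
      (\<Sum>J\<in>\<J>. real (num_matchings {f \<in> ?S \<union> ?R. f \<inter> J \<times> {r} = {}}))"
    unfolding R_eq by (subst sum.reindex[OF inj]) simp
  also have "\<dots> = num_matchings ?S * (\<Sum>J\<in>\<J>. \<Prod>i\<in>J - {z}. prob_uncovered (E i) r)"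
    using edge_term by (simp add: sum_distrib_left)
  finally have Z: "real (num_matchings (?S \<union> ?R)) =
      num_matchings ?S * (1 + (\<Sum>J\<in>\<J>. \<Prod>i\<in>J - {z}. prob_uncovered (E i) r))"
    by (simp add: algebra_simps)
  show ?thesis
    unfolding prob_uncovered_eq[OF finE] off Z using num_matchings_pos[OF finS] by simp
qed

section \<open>The constructions\<close>

text \<open>Induction on the degree: take \<open>k\<close> copies of a graph of degree
  \<open>d\<close> and, for each vertex, join its \<open>k\<close> copies by one new edge. The root
  here only records that the vertex set is nonempty.\<close>

lemma exists_regular_kgraph:
  assumes "k > 1"
  shows "\<exists>(V::nat set) E r. rooted_kgraph k d d V E r"
proof (induction d)
  case 0
  have "rooted_kgraph k 0 0 {0::nat} {} 0"
    by (simp add: rooted_kgraph_def finite_kgraph_def linear_hypergraph_def vertex_degree_def)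
  then show ?case by blast
next
  case (Suc d)
  then obtain V :: "nat set" and E r where "rooted_kgraph k d d V E r" by blast
  then have E: "finite_kgraph k V E" "linear_hypergraph E" "r \<in> V" "\<And>v. v \<in> V \<Longrightarrow> vertex_degree E v = d"
    by (auto simp: rooted_kgraph_def)
  let ?Q = "{{..<k}} \<times> V"
  let ?G = "sum_edges {..<k} (\<lambda>_. E) \<union> cross_edges ?Q"
  note G = sum_Un_cross_edges[where I = "{..<k}" and E = "\<lambda>_. E" and V = "\<lambda>_. V" and Q = ?Q and k = k]
  have "vertex_degree ?G (i, v) = Suc d" if "i < k" "v \<in> V" for i v
  proof -
    have "{J. (J, v) \<in> ?Q \<and> i \<in> J} = {{..<k}}" using that by auto
    then show ?thesis using that assms E by (subst G(3)) auto
  qed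
  moreover have "finite_kgraph k ({..<k} \<times> V) ?G" "linear_hypergraph ?G"
    using assms E by (intro G; auto)+
  ultimately have "rooted_kgraph k (Suc d) (Suc d) ({..<k} \<times> V) ?G (0, r)"
    unfolding rooted_kgraph_def using assms E by auto
  then show ?case using rooted_kgraph_to_nat by meson
qed

text \<open>
  The summand None is the new root alone; the summands Some (i, j) with j < k - 1 are the copies
  joined to it by its i-th edge.
\<close>
definition star :: "nat \<Rightarrow> nat \<Rightarrow> (nat \<times> nat) option set" where
  "star k i = insert None (Some ` ({i} \<times> {..<k - 1}))"

text \<open>At a fixed position \<open>j\<close>, the copies on \<open>k\<close> consecutive
  branches. With \<open>m * k\<close> branches the blocks partition all copies, and they serve as
  index sets of the edges that repair missing degrees.\<close>

definition block :: "nat \<Rightarrow> nat \<Rightarrow> nat \<Rightarrow> (nat \<times> nat) option set" where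
  "block k b j = Some ` ({b * k..<b * k + k} \<times> {j})"

definition copies :: "nat \<Rightarrow> nat \<Rightarrow> (nat \<times> nat) option set" where
  "copies k c = insert None (Some ` ({..<c} \<times> {..<k - 1}))"

section \<open>Incidence properties of stars and blocks\<close>

lemma finite_copies: "finite (copies k c)"
  by (simp add: copies_def)

lemma None_in_star: "None \<in> star k i"
  by (simp add: star_def)

lemma Some_in_star: "Some (a, b) \<in> star k i \<longleftrightarrow> a = i \<and> b < k - 1"
  by (auto simp: star_def)

lemma card_star: "k > 0 \<Longrightarrow> card (star k i) = k"
  unfolding star_def by (subst card_insert_disjoint) (auto simp: card_image card_cartesian_product)

lemma star_subset_copies: "i < c \<Longrightarrow> star k i \<subseteq> copies k c"
  by (auto simp: star_def copies_def)

lemma card_star_Int_star: "i \<noteq> i' \<Longrightarrow> card (star k i \<inter> star k i') \<le> 1"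
proof -
  assume "i \<noteq> i'"
  then have "star k i \<inter> star k i' = {None}" by (auto simp: star_def)
  then show ?thesis by simp
qed

lemma inj_star: "k > 1 \<Longrightarrow> inj (star k)"
proof (rule injI)
  fix i i' assume "k > 1" "star k i = star k i'"
  then have "Some (i, 0) \<in> star k i'" using Some_in_star[of i 0 k i] by simp
  then show "i = i'" by (simp add: Some_in_star)
qed

lemma None_notin_block: "None \<notin> block k b j"
  by (auto simp: block_def)

lemma Some_in_block:
  assumes "k > 0"
  shows "Some (i, j') \<in> block k b j \<longleftrightarrow> b = i div k \<and> j = j'"
proof -
  have "b * k \<le> i \<and> i < b * k + k \<longleftrightarrow> b = i div k"
  proof
    assume "b * k \<le> i \<and> i < b * k + k"
    then show "b = i div k"
      by (intro div_nat_eqI[symmetric]) (simp_all add: algebra_simps)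
  next
    assume "b = i div k"
    then have "b * k + i mod k = i" by simp
    moreover have "i mod k < k" using assms by simp
    ultimately show "b * k \<le> i \<and> i < b * k + k" by linarith
  qed
  then show ?thesis by (auto simp: block_def)
qed

lemma card_block: "card (block k b j) = k"
  by (simp add: block_def card_image card_cartesian_product)

lemma block_subset_copies:
  assumes "b < m" "j < k - 1"
  shows "block k b j \<subseteq> copies k (m * k)"
proof -
  have "b * k + k \<le> m * k" using assms by (metis Suc_leI add.commute mult_Suc mult_le_mono1)
  then show ?thesis using assms by (auto simp: block_def copies_def)
qed

lemma block_Int_block: "k > 0 \<Longrightarrow> (b, j) \<noteq> (b', j') \<Longrightarrow> block k b j \<inter> block k b' j' = {}"
proof (intro Int_emptyI)
  fix x assume "k > 0" "(b, j) \<noteq> (b', j')" "x \<in> block k b j" "x \<in> block k b' j'"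
  then show False by (cases x) (auto simp: None_notin_block Some_in_block)
qed

text \<open>The summand \<open>None\<close> is a single vertex without edges. It carries the name
  \<open>r\<close>, so that an edge over a star, which is constant in the second coordinate, joins
  it to the roots of the copies.\<close>

lemma finite_kgraph_case_option:
  assumes "finite_kgraph k V E"
  shows "finite_kgraph k (case_option {r} (\<lambda>_. V) i) (case_option {} (\<lambda>_. E) i)"
  using assms by (cases i) (simp_all add: finite_kgraph_def)

lemma linear_hypergraph_case_option:
  assumes "linear_hypergraph E"
  shows "linear_hypergraph (case_option {} (\<lambda>_. E) i)"
  using assms by (cases i) (simp_all add: linear_hypergraph_def)

text \<open>Each star joins the new root to \<open>k - 1\<close> copies whose roots are uncovered
  independently, so it contributes the power \<open>k - 1\<close> of their common probability. A
  copy meets exactly one star edge, at its root, whose degree rises from \<open>D\<close> to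
  \<open>Suc D\<close>. Leaving \<open>c\<close> free covers both repetition, with
  \<open>c = D\<close>, and completion to a regular graph, with \<open>c = Suc D\<close>.\<close>

lemma exists_tree_kgraph:
  fixes V :: "nat set"
  assumes k: "k > 1" and E: "rooted_kgraph k (Suc D) D V E r"
  shows "\<exists>(V'::nat set) E' r'. rooted_kgraph k (Suc D) c V' E' r' \<and>
    prob_uncovered E' r' = 1 / (1 + c * prob_uncovered E r ^ (k - 1))"
proof -
  let ?I = "copies k c" and ?E = "case_option {} (\<lambda>_. E)" and ?V = "case_option {r} (\<lambda>_. V)"
  let ?Q = "(star k ` {..<c}) \<times> {r}"
  have fin: "finite_kgraph k V E" and lin: "linear_hypergraph E" and r: "r \<in> V"
    and deg: "vertex_degree E r = D" "\<And>v. v \<in> V \<Longrightarrow> v \<noteq> r \<Longrightarrow> vertex_degree E v = Suc D"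
    using E by (auto simp: rooted_kgraph_def)
  have Q: "J \<subseteq> ?I \<and> card J = k \<and> (\<forall>i\<in>J. u \<in> ?V i)" if "(J, u) \<in> ?Q" for J u
    using that k r star_subset_copies by (auto simp: card_star split: option.splits)
  have Qlin: "card (J \<inter> J') \<le> 1" if "(J, u) \<in> ?Q" "(J', u) \<in> ?Q" "J \<noteq> J'" for J J' u
  proof -
    from that obtain i i' where "J = star k i" "J' = star k i'" by auto
    with that(3) card_star_Int_star[of i i' k] show ?thesis by auto
  qed
  let ?G = "sum_edges ?I ?E \<union> cross_edges ?Q"
  have G: "finite_kgraph k (Sigma ?I ?V) ?G" "linear_hypergraph ?G"
    "\<And>i v. i \<in> ?I \<Longrightarrow>
      vertex_degree ?G (i, v) = vertex_degree (?E i) v + card {J. (J, v) \<in> ?Q \<and> i \<in> J}"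
    by (rule sum_Un_cross_edges[where V = ?V and k = k, OF k finite_copies];
        (erule Q | erule (2) Qlin | assumption | rule finite_kgraph_case_option[OF fin]
          | rule linear_hypergraph_case_option[OF lin]))+
  have root: "{J. (J, r) \<in> ?Q \<and> None \<in> J} = star k ` {..<c}"
    by (auto simp: None_in_star)
  have inj: "inj_on (star k) {..<c}" using inj_star[OF k] by (rule inj_on_subset) simp
  have nonroot: "{J. (J, v) \<in> ?Q \<and> Some (i, j) \<in> J} = (if v = r then {star k i} else {})"
    if "i < c" "j < k - 1" for i j v
    using that by (auto simp: Some_in_star)
  have "rooted_kgraph k (Suc D) c (Sigma ?I ?V) ?G (None, r)"
    unfolding rooted_kgraph_def
  proof (intro conjI ballI)
    show "vertex_degree ?G (None, r) = c"
      by (subst G(3)) (simp_all only: root, simp_all add: copies_def card_image[OF inj] vertex_degree_def)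
    show "(None, r) \<in> Sigma ?I ?V" by (simp add: copies_def)
    fix x assume "x \<in> Sigma ?I ?V - {(None, r)}"
    then obtain i j v where x: "x = (Some (i, j), v)" "i < c" "j < k - 1" "v \<in> V"
      by (auto simp: copies_def)
    then have "Some (i, j) \<in> ?I" by (auto simp: copies_def)
    then show "vertex_degree ?G x = Suc D"
      unfolding x(1) by (subst G(3)) (simp_all only: nonroot[OF x(2,3)], use x deg in auto)
  qed (use G in simp_all)
  moreover have "prob_uncovered ?G (None, r) =
    1 / (1 + c * prob_uncovered E r ^ (k - 1))"
  proof -
    have "prob_uncovered ?G (None, r) =
      1 / (1 + (\<Sum>J\<in>star k ` {..<c}. \<Prod>i\<in>J - {None}. prob_uncovered (?E i) r))"
      using finite_kgraph_finite[OF fin] finite_kgraph_nonempty[OF fin] k star_subset_copies[of _ c k]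
      by (intro prob_uncovered_cross_edges) (auto simp: finite_copies None_in_star copies_def split: option.splits)
    also have "(\<Sum>J\<in>star k ` {..<c}. \<Prod>i\<in>J - {None}. prob_uncovered (?E i) r) =
      (\<Sum>i<c. \<Prod>x\<in>star k i - {None}. prob_uncovered (?E x) r)"
      by (rule sum.reindex_cong[OF inj refl refl])
    also have "\<dots> = (\<Sum>i<c. prob_uncovered E r ^ (k - 1))"
    proof (rule sum.cong)
      fix i
      have "(\<Prod>x\<in>star k i - {None}. prob_uncovered (?E x) r) = (\<Prod>x\<in>star k i - {None}. prob_uncovered E r)"
        by (intro prod.cong) auto
      then show "(\<Prod>x\<in>star k i - {None}. prob_uncovered (?E x) r) = prob_uncovered E r ^ (k - 1)"
        using k card_star[of k i] None_in_star[of k i] by (simp add: card_Diff_singleton)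
    qed simp
    finally show ?thesis by simp
  qed
  ultimately show ?thesis using rooted_kgraph_to_nat by metis
qed

text \<open>
  Removing an edge e from a regular k-graph leaves k deficient vertices. In D(k - 1) copies, those at
  r are repaired by the edges of a new root, those at the other vertices of e by grouping
  the copies in blocks of size k, which is where k must divide D.
\<close>
lemma exists_deficient_kgraph:
  assumes k: "k > 1"
  shows "\<exists>(V::nat set) E r. rooted_kgraph k (Suc (m * k)) (m * k) V E r"
proof -
  let ?D = "m * k"
  obtain V :: "nat set" and H r where H: "rooted_kgraph k (Suc ?D) (Suc ?D) V H r"
    using exists_regular_kgraph[OF k] by blast
  have finH: "finite_kgraph k V H" and linH: "linear_hypergraph H" and r: "r \<in> V"
    and degH: "\<And>v. v \<in> V \<Longrightarrow> vertex_degree H v = Suc ?D"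
    using H by (auto simp: rooted_kgraph_def)
  have "{e\<in>H. r \<in> e} \<noteq> {}"
    using degH[OF r] unfolding vertex_degree_def by (metis card.empty nat.distinct(1))
  then obtain e where e: "e \<in> H" "r \<in> e" by blast
  have eV: "e \<subseteq> V" using finH e by (auto simp: finite_kgraph_def)
  define E where "E = H - {e}"
  have fin: "finite_kgraph k V E" using finH by (auto simp: finite_kgraph_def E_def)
  have lin: "linear_hypergraph E" using linH by (auto simp: linear_hypergraph_def E_def)
  have deg: "vertex_degree E v = (if v \<in> e then ?D else Suc ?D)" if "v \<in> V" for v
  proof -
    have "{f\<in>E. v \<in> f} = {f\<in>H. v \<in> f} - (if v \<in> e then {e} else {})"
      by (auto simp: E_def)
    then show ?thesis
      using degH[OF that] e finite_kgraph_finite[OF finH] by (simp add: vertex_degree_def card_Diff_singleton)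
  qed
  let ?I = "copies k ?D" and ?E = "case_option {} (\<lambda>_. E)" and ?V = "case_option {r} (\<lambda>_. V)"
  let ?B = "(\<lambda>(b, j). block k b j) ` ({..<m} \<times> {..<k - 1})"
  \<comment> \<open>Stars are used only at \<open>r\<close> and blocks only at the other vertices of
    \<open>e\<close>, so edges of different sorts are disjoint and linearity can be checked within
    each sort.\<close>
  let ?Q = "(star k ` {..<?D}) \<times> {r} \<union> ?B \<times> (e - {r})"
  have QV: "u \<in> ?V i" if "(J, u) \<in> ?Q" "i \<in> J" for J u i
    using that r eV None_notin_block by (cases i) auto
  have Q: "J \<subseteq> ?I \<and> card J = k \<and> (\<forall>i\<in>J. u \<in> ?V i)" if Ju: "(J, u) \<in> ?Q" for J u
  proof -
    from Ju consider i where "i < ?D" "J = star k i" | b j where "b < m" "j < k - 1" "J = block k b j"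
      by auto
    then have "J \<subseteq> ?I \<and> card J = k"
      using k by cases (simp_all add: star_subset_copies block_subset_copies card_star card_block)
    with QV[OF Ju] show ?thesis by blast
  qed
  have Qlin: "card (J \<inter> J') \<le> 1" if J: "(J, u) \<in> ?Q" "(J', u) \<in> ?Q" "J \<noteq> J'" for J J' u
  proof (cases "u = r")
    case True
    with J obtain i i' where "J = star k i" "J' = star k i'" by auto
    with J(3) card_star_Int_star[of i i' k] show ?thesis by auto
  next
    case False
    with J obtain b j b' j' where B: "J = block k b j" "J' = block k b' j'" by auto
    with J(3) have "(b, j) \<noteq> (b', j')" by auto
    with k have "J \<inter> J' = {}" unfolding B by (intro block_Int_block) simp_all
    then show ?thesis by simp
  qed
  let ?G = "sum_edges ?I ?E \<union> cross_edges ?Q"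
  have G: "finite_kgraph k (Sigma ?I ?V) ?G" "linear_hypergraph ?G"
    "\<And>i v. i \<in> ?I \<Longrightarrow>
      vertex_degree ?G (i, v) = vertex_degree (?E i) v + card {J. (J, v) \<in> ?Q \<and> i \<in> J}"
    by (rule sum_Un_cross_edges[where V = ?V and k = k, OF k finite_copies];
        (erule Q | erule (2) Qlin | assumption | rule finite_kgraph_case_option[OF fin]
          | rule linear_hypergraph_case_option[OF lin]))+
  have root: "{J. (J, r) \<in> ?Q \<and> None \<in> J} = star k ` {..<?D}"
    by (auto simp: None_in_star)
  have inj: "inj_on (star k) {..<?D}" using inj_star[OF k] by (rule inj_on_subset) simp
  \<comment> \<open>Every vertex of \<open>e\<close> gets back exactly one edge in each copy, in
    place of the removed \<open>e\<close>: its star if it is \<open>r\<close>, otherwise the block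
    numbered \<open>i div k\<close>.\<close>
  have nonroot: "card {J. (J, v) \<in> ?Q \<and> Some (i, j) \<in> J} = (if v \<in> e then 1 else 0)"
    if ij: "i < ?D" "j < k - 1" for i j v
  proof -
    have "i div k < m" using ij by (simp add: less_mult_imp_div_less)
    then have "{J. (J, v) \<in> ?Q \<and> Some (i, j) \<in> J} =
      (if v = r then {star k i} else if v \<in> e then {block k (i div k) j} else {})"
      using ij k by (auto simp: Some_in_star Some_in_block)
    then show ?thesis using e by simp
  qed
  have "rooted_kgraph k (Suc ?D) ?D (Sigma ?I ?V) ?G (None, r)"
    unfolding rooted_kgraph_def
  proof (intro conjI ballI)
    show "vertex_degree ?G (None, r) = ?D"
      by (subst G(3)) (simp_all only: root, simp_all add: copies_def card_image[OF inj] vertex_degree_def)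
    show "(None, r) \<in> Sigma ?I ?V" by (simp add: copies_def)
    fix x assume "x \<in> Sigma ?I ?V - {(None, r)}"
    then obtain i j v where x: "x = (Some (i, j), v)" "i < ?D" "j < k - 1" "v \<in> V"
      by (auto simp: copies_def)
    then have "Some (i, j) \<in> ?I" by (auto simp: copies_def)
    then show "vertex_degree ?G x = Suc ?D"
      unfolding x(1) by (subst G(3)) (simp_all only: nonroot[OF x(2,3)], use x deg in auto)
  qed (use G in simp_all)
  then show ?thesis using rooted_kgraph_to_nat by blast
qed

text \<open>A disjoint union preserves the probabilities at both roots, so the two extreme vertices
  may be built separately. The Boolean tag also makes them distinct.\<close>

lemma regular_union:
  fixes V\<^sub>1 V\<^sub>2 :: "nat set"
  assumes "rooted_kgraph k d d V\<^sub>1 E\<^sub>1 r\<^sub>1" "rooted_kgraph k d d V\<^sub>2 E\<^sub>2 r\<^sub>2" and k: "k > 0"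
  shows "\<exists>(V::nat set) E. finite_kgraph k V E \<and> linear_hypergraph E \<and> regular_hypergraph d V E \<and>
    (\<exists>v\<^sub>1\<in>V. \<exists>v\<^sub>2\<in>V. v\<^sub>1 \<noteq> v\<^sub>2 \<and> prob_uncovered E v\<^sub>1 = prob_uncovered E\<^sub>1 r\<^sub>1 \<and>
       prob_uncovered E v\<^sub>2 = prob_uncovered E\<^sub>2 r\<^sub>2)"
proof -
  let ?V = "\<lambda>b. if b then V\<^sub>1 else V\<^sub>2" and ?E = "\<lambda>b. if b then E\<^sub>1 else E\<^sub>2"
  let ?f = "to_nat :: bool \<times> nat \<Rightarrow> nat" and ?S = "sum_edges UNIV ?E"
  note R = assms(1,2)[unfolded rooted_kgraph_def]
  have fin: "finite_kgraph k (?V b) (?E b)" for b using R by simp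
  have finS: "finite_kgraph k (Sigma UNIV ?V) ?S"
    using fin by (intro finite_kgraph_sum_edges) auto
  have linS: "linear_hypergraph ?S" using R by (intro linear_sum_edges) simp
  have deg: "vertex_degree ?S x = d" if "x \<in> Sigma UNIV ?V" for x
    using that R by (cases x) (auto simp: vertex_degree_sum_edges split: if_splits)
  have prob: "prob_uncovered ?S (b, v) = prob_uncovered (?E b) v" for b v
    using finite_kgraph_finite[OF fin] finite_kgraph_nonempty[OF fin k]
    by (intro prob_uncovered_sum_edges) simp_all
  let ?W = "?f ` Sigma UNIV ?V" and ?F = "(`) ?f ` ?S"
  have probF: "prob_uncovered ?F (?f x) = prob_uncovered ?S x" for x
    by (intro prob_uncovered_image finite_kgraph_finite[OF finS]) simp
  have "finite_kgraph k ?W ?F" "linear_hypergraph ?F"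
    by (simp_all add: finite_kgraph_image finS linear_hypergraph_image linS)
  moreover have "regular_hypergraph d ?W ?F"
    unfolding regular_hypergraph_def using deg vertex_degree_image[of ?f ?S]
    by (auto simp flip: vertex_degree_def)
  moreover have "?f (True, r\<^sub>1) \<in> ?W" "?f (False, r\<^sub>2) \<in> ?W" using R by auto
  moreover have "?f (True, r\<^sub>1) \<noteq> ?f (False, r\<^sub>2)" by simp
  moreover have "prob_uncovered ?F (?f (True, r\<^sub>1)) = prob_uncovered E\<^sub>1 r\<^sub>1"
    "prob_uncovered ?F (?f (False, r\<^sub>2)) = prob_uncovered E\<^sub>2 r\<^sub>2"
    unfolding probF prob by simp_all
  ultimately show ?thesis by blast
qed

section \<open>The recursion for the root probability\<close>

text \<open>Multiplying the inequality for \<open>a\<close> by \<open>a\<close> bounds a(1 - a) by D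
  a^2 b^2 b^(k-3). As k > 2, replacing b^(k-3) by a^(k-3) only increases this, and by the equation
  for \<open>b\<close> the result is b(1 - b). Then (a - b)(1 - a - b) \<le> 0, and
  \<open>b < a\<close> decides the sign.\<close>

lemma two_cycle_sum_ge_1:
  fixes a b D :: real
  assumes "k > 2" "D > 0" "0 < b" "b < a"
    and b: "b * (1 + D * a ^ (k - 1)) = 1" and a: "1 \<le> a * (1 + D * b ^ (k - 1))"
  shows "a + b \<ge> 1"
proof -
  obtain n where n: "k = n + 3" using \<open>k > 2\<close> by (intro that[of "k - 3"]) simp
  have "b ^ n \<le> a ^ n" using assms by (intro power_mono) auto
  have "a * (1 - a) \<le> a * (D * a * b ^ (n + 2))"
    using a assms unfolding n by (intro mult_left_mono) (auto simp: algebra_simps)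
  also have "\<dots> = D * a ^ 2 * b ^ 2 * b ^ n" by (simp add: power2_eq_square)
  also have "\<dots> \<le> D * a ^ 2 * b ^ 2 * a ^ n"
    using \<open>b ^ n \<le> a ^ n\<close> assms by (intro mult_left_mono) auto
  also have "\<dots> = b * (b * (1 + D * a ^ (k - 1)) - b)"
    unfolding n by (simp add: algebra_simps power2_eq_square)
  also have "\<dots> = b * (1 - b)"
    by (simp only: b)
  finally have "(a - b) * (1 - (a + b)) \<le> 0" by (simp add: algebra_simps)
  then show ?thesis using \<open>b < a\<close> by (simp add: mult_le_0_iff)
qed

text \<open>\<open>P\<close> stands for being attained as a root probability. The assumption on
  \<open>\<delta>\<close> puts the fixed point below \<open>\<delta>\<close>, and the one on
  \<open>x\<^sub>0\<close> says that the orbit does not start there.\<close>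

lemma recursion_approaches_1:
  fixes D \<delta> :: real
  assumes k: "k > 2" and D: "D > 0" and \<delta>: "\<delta> > 0" "D * \<delta> ^ k > 1"
    and P0: "P x\<^sub>0" "x\<^sub>0 > 0" and x\<^sub>0: "x\<^sub>0 * (1 + D * x\<^sub>0 ^ (k - 1)) \<noteq> 1"
    and step: "\<And>x. P x \<Longrightarrow> P (1 / (1 + D * x ^ (k - 1)))"
  shows "\<exists>x. P x \<and> 1 - \<delta> < x \<and> x \<le> 1"
proof -
  define f where "f x = 1 / (1 + D * x ^ (k - 1))" for x :: real
  have f_pos: "f x > 0" if "x \<ge> 0" for x
    using that D by (simp add: f_def add_pos_nonneg)
  have f_le: "f x \<le> 1" if "x \<ge> 0" for x
    using that D by (simp add: f_def divide_le_eq add_pos_nonneg)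
  have f_less: "f y < f x" if "0 \<le> x" "x < y" for x y
  proof -
    have "x ^ (k - 1) < y ^ (k - 1)" using that k by (intro power_strict_mono) auto
    then show ?thesis using that D unfolding f_def
      by (intro divide_strict_left_mono) (auto intro!: mult_pos_pos add_pos_nonneg)
  qed
  have f_mult: "f x * (1 + D * x ^ (k - 1)) = 1" if "x \<ge> 0" for x
    using that D by (simp add: f_def add_pos_nonneg add_nonneg_eq_0_iff)
  have cont: "isCont f x" if "x \<ge> 0" for x
    unfolding f_def using that D by (intro continuous_intros) (simp add: add_nonneg_eq_0_iff)
  \<comment> \<open>The function is 0 at 0 and 1 + D at 1, so it takes the value 1 between
    them.\<close>
  obtain p where p: "0 \<le> p" "p \<le> 1" "p * (1 + D * p ^ (k - 1)) = 1"
    using IVT[of "\<lambda>x. x * (1 + D * x ^ (k - 1))" 0 1 1] D by (auto intro!: continuous_intros)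
  then have "p > 0" by (cases "p = 0") auto
  have fp: "f p = p" using p D by (simp add: f_def nonzero_divide_eq_eq add_nonneg_eq_0_iff field_simps)
  \<comment> \<open>The equation for \<open>p\<close> gives D p^k = 1 - p \<le> 1, against
    \<open>D * \<delta> ^ k > 1\<close>.\<close>
  have p_less: "p < \<delta>"
  proof (rule ccontr)
    assume "\<not> p < \<delta>"
    then have "D * \<delta> ^ k \<le> D * p ^ k" using D \<delta> by (intro mult_left_mono power_mono) auto
    also have "D * p ^ k = p * (D * p ^ (k - 1))" using k by (simp add: power_eq_if)
    also have "\<dots> \<le> 1" using p by (simp add: algebra_simps)
    finally show False using \<delta> by simp
  qed
  \<comment> \<open>Since \<open>f\<close> is decreasing, f(a) < p < \<delta>, and the sum bound
    yields a \<ge> 1 - f(a) > 1 - \<delta>.\<close>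
  have key: "1 - \<delta> < a" if a: "p < a" "f (f a) \<le> a" for a
  proof -
    have a0: "0 \<le> a" using a p by simp
    have fa: "0 < f a" "f a < p" using f_pos[OF a0] f_less[OF p(1) a(1)] fp by auto
    have "1 = f (f a) * (1 + D * f a ^ (k - 1))" using f_mult[of "f a"] fa by simp
    also have "\<dots> \<le> a * (1 + D * f a ^ (k - 1))" using a fa D by (intro mult_right_mono) auto
    finally have "a + f a \<ge> 1"
      using two_cycle_sum_ge_1[of k D "f a" a] k D fa a f_mult[OF a0] by auto
    then show ?thesis using fa p_less by simp
  qed
  have "x\<^sub>0 \<noteq> p" using p x\<^sub>0 by auto
  \<comment> \<open>Each application of \<open>f\<close> switches the side of \<open>p\<close>, so
    one or two applications lead above \<open>p\<close>. At least one is always made, because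
    \<open>x\<^sub>0 \<le> 1\<close> is not assumed.\<close>
  obtain y where y: "P y" "p < y" "y \<le> 1"
  proof (cases "x\<^sub>0 < p")
    case True
    then show ?thesis
      using that[of "f x\<^sub>0"] step[OF P0(1)] f_less[of x\<^sub>0 p] f_le[of x\<^sub>0] P0 fp by (auto simp: f_def)
  next
    case False
    then have "p < x\<^sub>0" using \<open>x\<^sub>0 \<noteq> p\<close> by simp
    then have "0 \<le> f x\<^sub>0" "f x\<^sub>0 < p" using f_less[of p x\<^sub>0] f_pos[of x\<^sub>0] P0 p fp by auto
    then have "p < f (f x\<^sub>0)" "f (f x\<^sub>0) \<le> 1" using f_less[of "f x\<^sub>0" p] f_le[of "f x\<^sub>0"] fp by auto
    moreover have "P (f (f x\<^sub>0))" using step[OF step[OF P0(1)]] by (simp add: f_def)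
    ultimately show ?thesis using that by blast
  qed
  define g where "g n = ((f \<circ> f) ^^ n) y" for n
  have g_Suc: "g (Suc n) = f (f (g n))" for n by (simp add: g_def)
  have g: "P (g n) \<and> p < g n \<and> g n \<le> 1" for n
  proof (induction n)
    case 0
    then show ?case using y by (simp add: g_def)
  next
    case (Suc n)
    then have gn: "P (g n)" "p < g n" "0 \<le> g n" using p by auto
    then have "0 \<le> f (g n)" "f (g n) < p" using f_less[of p "g n"] f_pos[of "g n"] p fp by auto
    then have "p < f (f (g n))" "f (f (g n)) \<le> 1" using f_less[of "f (g n)" p] f_le[of "f (g n)"] fp by auto
    moreover have "P (f (f (g n)))" using step[OF step[OF gn(1)]] by (simp add: f_def)
    ultimately show ?case by (simp add: g_Suc)
  qed
  show ?thesis
  \<comment> \<open>Either some iterate already satisfies the condition of \<open>key\<close>, or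
    the sequence increases to a limit above \<open>p\<close>. By continuity this limit is fixed
    under \<open>f \<circ> f\<close>, so \<open>key\<close> applies to it and late iterates exceed 1
    - \<delta>.\<close>
  proof (cases "\<exists>n. f (f (g n)) \<le> g n")
    case True
    then show ?thesis using key g by blast
  next
    case False
    then have inc: "incseq g" by (intro incseq_SucI) (auto simp: g_Suc not_le intro: less_imp_le)
    then obtain L where L: "g \<longlonglongrightarrow> L" "\<And>n. g n \<le> L"
      using incseq_convergent[OF inc, of 1] g by blast
    have Lp: "p < L" using g[of 0] L(2)[of 0] by simp
    then have "0 \<le> L" using p by simp
    have "(\<lambda>n. f (f (g n))) \<longlonglongrightarrow> f (f L)"
      using \<open>0 \<le> L\<close> f_pos[of L] by (intro isCont_tendsto_compose[OF cont] L) auto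
    moreover have "(\<lambda>n. f (f (g n))) \<longlonglongrightarrow> L"
      using LIMSEQ_Suc[OF L(1)] by (simp add: g_Suc)
    ultimately have "f (f L) = L" using LIMSEQ_unique by blast
    then have "1 - \<delta> < L" using key Lp by simp
    then obtain n where "1 - \<delta> < g n"
      using order_tendstoD(1)[OF L(1)] by (metis eventually_sequentially order_refl)
    then show ?thesis using g by blast
  qed
qed

text \<open>For x = a/b in lowest terms the equation becomes b^k = a (b^(k-1) + s^k a^(k-1)). Thus a
  divides b^k, which forces a = 1 and s^k = b^(k-1) (b - 1). But then s < b, so s^k \<le> (b - 1)^k
  < b^(k-1) (b - 1), a contradiction.\<close>

lemma power_recursion_no_rational_fixpoint:
  fixes x :: real
  assumes k: "k > 1" and s: "s > 0" and x: "x \<in> \<rat>" "x > 0"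
  shows "x * (1 + real (s ^ k) * x ^ (k - 1)) \<noteq> 1"
proof
  assume eq: "x * (1 + real (s ^ k) * x ^ (k - 1)) = 1"
  obtain a b :: nat where ab: "b \<noteq> 0" "\<bar>x\<bar> = real a / real b" "coprime a b"
    using Rats_abs_nat_div_natE[OF x(1)] by metis
  obtain n where n: "k = n + 2" using k by (intro that[of "k - 2"]) simp
  have xab: "x * b = a" using ab x by simp
  have "real (b ^ k) = x * (1 + real (s ^ k) * x ^ (k - 1)) * real b ^ k"
    using eq by simp
  also have "\<dots> = (x * b) * b ^ (k - 1) + real (s ^ k) * (x * b) ^ k"
    unfolding n by (simp add: algebra_simps)
  also have "\<dots> = real (a * (b ^ (k - 1) + s ^ k * a ^ (k - 1)))"
    unfolding xab n by (simp add: algebra_simps)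
  finally have nat_eq: "b ^ k = a * (b ^ (k - 1) + s ^ k * a ^ (k - 1))"
    by (simp only: of_nat_eq_iff)
  then have "a dvd b ^ k" by simp
  moreover have "coprime a (b ^ k)" using ab by simp
  ultimately have "a = 1" by (metis coprime_absorb_left nat_dvd_1_iff_1)
  with nat_eq have b: "b ^ k = b ^ (k - 1) + s ^ k" by simp
  with ab have "s ^ k < b ^ k" by simp
  then have "s < b" using power_less_imp_less_base by blast
  then obtain c where c: "b = Suc c" "s \<le> c" by (cases b) auto
  have "s ^ k \<le> c ^ k" using c by (intro power_mono) auto
  also have "\<dots> = c * c ^ (k - 1)" using k by (simp add: power_eq_if)
  also have "\<dots> < c * b ^ (k - 1)"
    using k c s by (intro mult_strict_left_mono power_strict_mono) auto
  finally have "b ^ (k - 1) + s ^ k < b * b ^ (k - 1)" using c by simp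
  with b k show False by (simp add: power_eq_if)
qed

section \<open>Choice of the error term and the final estimates\<close>

lemma near_1_power:
  fixes \<epsilon> :: real
  assumes "\<epsilon> > 0"
  obtains \<delta> where "0 < \<delta>" "\<delta> < 1" "\<And>a. 1 - \<delta> < a \<Longrightarrow> a \<le> 1 \<Longrightarrow> 1 < (1 + \<epsilon>) * a ^ n"
proof -
  have "((\<lambda>\<delta>. (1 + \<epsilon>) * (1 - \<delta>) ^ n) \<longlongrightarrow> (1 + \<epsilon>) * (1 - 0) ^ n) (at_right 0)"
    by (intro tendsto_intros)
  then have "\<forall>\<^sub>F \<delta> in at_right 0. 1 < (1 + \<epsilon>) * (1 - \<delta>) ^ n"
    using assms by (intro order_tendstoD(1)) auto
  moreover have "\<forall>\<^sub>F \<delta> in at_right (0::real). \<delta> \<in> {0<..<1}"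
    by (rule eventually_at_right_real) simp
  ultimately have "\<forall>\<^sub>F \<delta> in at_right 0. \<delta> \<in> {0<..<1} \<and> 1 < (1 + \<epsilon>) * (1 - \<delta>) ^ n"
    by eventually_elim simp
  then obtain \<delta> where \<delta>: "0 < \<delta>" "\<delta> < 1" "1 < (1 + \<epsilon>) * (1 - \<delta>) ^ n"
    using eventually_happens[of _ "at_right (0::real)"] trivial_limit_at_right_real[of 0]
    by (metis (lifting) greaterThanLessThan_iff)
  have "1 < (1 + \<epsilon>) * a ^ n" if "1 - \<delta> < a" for a
  proof -
    have "(1 + \<epsilon>) * (1 - \<delta>) ^ n \<le> (1 + \<epsilon>) * a ^ n"
      using that \<delta> assms by (intro mult_left_mono power_mono) auto
    with \<delta>(3) show ?thesis by simp
  qed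
  with \<delta> show ?thesis using that by blast
qed

text \<open>Put A = a^(k-1). As A \<le> 1 and d = D + 1, the value 1/(1 + D A) is at most 1/(d A);
  its power k - 1 times d is below (1 + \<epsilon>)/d^(k-2), and 1/(1 + t) \<ge> 1 - t gives the
  first bound. The second follows from (1 + \<epsilon>) A > 1. The exponent in \<open>large\<close>
  is that of A^(k-1) written in \<open>a\<close>.\<close>

lemma root_bounds:
  fixes a \<epsilon> :: real
  assumes k: "k > 2" and D: "d = Suc D" and \<epsilon>: "\<epsilon> > 0" and a: "0 < a" "a \<le> 1"
    and large: "1 < (1 + \<epsilon>) * a ^ ((k - 1) * (k - 1))"
  shows "1 / (1 + real d * (1 / (1 + real D * a ^ (k - 1))) ^ (k - 1)) > 1 - (1 + \<epsilon>) / real d ^ (k - 2)"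
    and "1 / (1 + real d * a ^ (k - 1)) < (1 + \<epsilon>) / (real d + 1)"
proof -
  define A where "A = a ^ (k - 1)"
  have A: "0 < A" "A \<le> 1" using a by (auto simp: A_def power_le_one)
  have large': "1 < (1 + \<epsilon>) * A ^ (k - 1)" using large by (simp add: A_def power_mult)
  have d: "real d > 0" using D by simp
  obtain n where n: "k - 1 = Suc n" "k - 2 = n" using k by (intro that[of "k - 2"]) auto
  have "real d * A \<le> 1 + real D * A" using A D by (simp add: algebra_simps)
  then have "1 / (1 + real D * A) \<le> 1 / (real d * A)"
    using A d by (intro divide_left_mono) (auto intro!: mult_pos_pos add_pos_nonneg)
  then have "(1 / (1 + real D * A)) ^ (k - 1) \<le> (1 / (real d * A)) ^ (k - 1)"
    using A by (intro power_mono) auto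
  then have "real d * (1 / (1 + real D * A)) ^ (k - 1) \<le> real d * (1 / (real d * A)) ^ (k - 1)"
    using d by (intro mult_left_mono) auto
  also have "\<dots> = 1 / A ^ (k - 1) / real d ^ (k - 2)"
    using d A unfolding n by (simp add: power_divide power_mult_distrib)
  also have "\<dots> < (1 + \<epsilon>) / real d ^ (k - 2)"
    using d A large' by (intro divide_strict_right_mono) (auto simp: pos_divide_less_eq)
  finally have less: "real d * (1 / (1 + real D * A)) ^ (k - 1) < (1 + \<epsilon>) / real d ^ (k - 2)" .
  have "1 - t \<le> 1 / (1 + t)" if "t \<ge> 0" for t :: real
    using that by (simp add: le_divide_eq algebra_simps)
  from this[of "real d * (1 / (1 + real D * A)) ^ (k - 1)"] less A
  show "1 / (1 + real d * (1 / (1 + real D * a ^ (k - 1))) ^ (k - 1)) > 1 - (1 + \<epsilon>) / real d ^ (k - 2)"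
    unfolding A_def by simp
  \<comment> \<open>Since A \<le> 1, the assumption on A^(k-1) also controls A itself.\<close>
  have "A ^ (k - 1) \<le> A" using A unfolding n by (simp add: mult_left_le power_le_one)
  then have "(1 + \<epsilon>) * A ^ (k - 1) \<le> (1 + \<epsilon>) * A" using \<epsilon> by (intro mult_left_mono) auto
  with large' have *: "1 < (1 + \<epsilon>) * A" by simp
  then have "real d < real d * ((1 + \<epsilon>) * A)" using d by simp
  with * \<epsilon> have "real d + 1 < (1 + \<epsilon>) * (1 + real d * A)" by (simp add: algebra_simps)
  then show "1 / (1 + real d * a ^ (k - 1)) < (1 + \<epsilon>) / (real d + 1)"
    unfolding A_def[symmetric] using A d
    by (simp add: divide_less_eq less_divide_eq add_pos_pos)
qed

text \<open>For \<open>d = Suc D\<close> and \<open>c = D\<close> this is the property carried along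
  the recursion; the fixed vertex type \<open>nat\<close> makes it closed under the tree
  construction.\<close>

definition root_prob :: "nat \<Rightarrow> nat \<Rightarrow> nat \<Rightarrow> real \<Rightarrow> bool" where
  "root_prob k d c x \<longleftrightarrow> (\<exists>(V::nat set) E r. rooted_kgraph k d c V E r \<and> prob_uncovered E r = x)"

lemma root_prob_tree:
  assumes "k > 1" "root_prob k (Suc D) D x"
  shows "root_prob k (Suc D) c (1 / (1 + real c * x ^ (k - 1)))"
  using assms exists_tree_kgraph unfolding root_prob_def by meson

theorem theorem1p4:
  fixes k :: nat and d\<^sub>0 \<epsilon> :: real
  assumes "k > 2" and "d\<^sub>0 > 0" and "\<epsilon> > 0"
  shows "\<exists>(d::nat) (V::nat set) (E::nat set set).
           real d > d\<^sub>0 \<and>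
           finite_kgraph k V E \<and> linear_hypergraph E \<and> regular_hypergraph d V E \<and>
           (\<exists>v\<^sub>1\<in>V. \<exists>v\<^sub>2\<in>V. v\<^sub>1 \<noteq> v\<^sub>2 \<and>
              prob_uncovered E v\<^sub>1 > 1 - (1 + \<epsilon>) / real d ^ (k - 2) \<and>
              prob_uncovered E v\<^sub>2 < (1 + \<epsilon>) / (real d + 1))"
proof -
  have k: "k > 1" using assms by simp
  obtain \<delta> where \<delta>: "0 < \<delta>" "\<delta> < 1"
    "\<And>a. 1 - \<delta> < a \<Longrightarrow> a \<le> 1 \<Longrightarrow> 1 < (1 + \<epsilon>) * a ^ ((k - 1) * (k - 1))"
    using near_1_power[OF \<open>\<epsilon> > 0\<close>] by blast
  \<comment> \<open>The first bound makes the degree exceed \<open>d\<^sub>0\<close>, the second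
    makes the fixed point of the recursion smaller than \<open>\<delta>\<close>.\<close>
  obtain t :: nat where t: "real t > max d\<^sub>0 (1 / \<delta> ^ k)"
    using reals_Archimedean2 by blast
  then have "t > 0" using \<open>d\<^sub>0 > 0\<close> by (cases t) auto
  \<comment> \<open>The factor \<open>k\<close> makes D = s^k divisible by k, as the block
    construction requires, while D stays a k-th power, as the irrationality argument
    requires.\<close>
  define s where "s = k * t"
  define D where "D = s ^ k"
  have s: "s > 0" using k \<open>t > 0\<close> by (simp add: s_def)
  have D_eq: "D = (k ^ (k - 1) * t ^ k) * k"
    using k power_minus_mult[of k k] by (simp add: D_def s_def power_mult_distrib)
  have "t \<le> s" using k by (simp add: s_def)
  also have "s \<le> D" unfolding D_def using k s by (intro self_le_power) auto
  finally have "real t \<le> real D" by simp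
  with t have D: "real D > d\<^sub>0" "real D > 1 / \<delta> ^ k" by auto
  obtain V :: "nat set" and E r where H: "rooted_kgraph k (Suc D) D V E r"
    using exists_deficient_kgraph[OF k] unfolding D_eq by blast
  define x\<^sub>0 where "x\<^sub>0 = prob_uncovered E r"
  have "finite E" using H finite_kgraph_finite by (auto simp: rooted_kgraph_def)
  then have "x\<^sub>0 > 0" "x\<^sub>0 \<in> \<rat>"
    unfolding x\<^sub>0_def by (simp add: prob_uncovered_pos, simp add: prob_uncovered_eq)
  then have x0: "x\<^sub>0 * (1 + real D * x\<^sub>0 ^ (k - 1)) \<noteq> 1"
    unfolding D_def using k s by (intro power_recursion_no_rational_fixpoint)
  have "\<exists>a. root_prob k (Suc D) D a \<and> 1 - \<delta> < a \<and> a \<le> 1"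
  proof (rule recursion_approaches_1[OF \<open>k > 2\<close> _ \<delta>(1) _ _ \<open>x\<^sub>0 > 0\<close> x0])
    show "real D > 0" using D \<open>d\<^sub>0 > 0\<close> by linarith
    show "1 < real D * \<delta> ^ k" using D \<delta> by (simp add: divide_less_eq)
    show "root_prob k (Suc D) D x\<^sub>0" using H unfolding root_prob_def x\<^sub>0_def by blast
  qed (rule root_prob_tree[OF k])
  then obtain a where a: "root_prob k (Suc D) D a" "1 - \<delta> < a" "a \<le> 1" by blast
  have "a > 0" using a \<delta> by simp
  note bounds = root_bounds[OF \<open>k > 2\<close> refl \<open>\<epsilon> > 0\<close> \<open>a > 0\<close> a(3) \<delta>(3)[OF a(2,3)], of D]
  \<comment> \<open>This is the next value of the recursion after \<open>a\<close>, and it is small.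
    A vertex joined to roots of probability \<open>?b\<close> is mostly uncovered, one joined to
    roots of probability \<open>a\<close> is mostly covered; using \<open>Suc D\<close> stars makes
    both graphs regular.\<close>
  let ?b = "1 / (1 + real D * a ^ (k - 1))"
  have "root_prob k (Suc D) (Suc D) (1 / (1 + real (Suc D) * ?b ^ (k - 1)))"
    "root_prob k (Suc D) (Suc D) (1 / (1 + real (Suc D) * a ^ (k - 1)))"
    using a(1) by (intro root_prob_tree[OF k]; simp)+
  then obtain V\<^sub>1 E\<^sub>1 r\<^sub>1 V\<^sub>2 E\<^sub>2 r\<^sub>2 where
    G\<^sub>1: "rooted_kgraph k (Suc D) (Suc D) (V\<^sub>1 :: nat set) E\<^sub>1 r\<^sub>1"
      "prob_uncovered E\<^sub>1 r\<^sub>1 = 1 / (1 + real (Suc D) * ?b ^ (k - 1))" and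
    G\<^sub>2: "rooted_kgraph k (Suc D) (Suc D) (V\<^sub>2 :: nat set) E\<^sub>2 r\<^sub>2"
      "prob_uncovered E\<^sub>2 r\<^sub>2 = 1 / (1 + real (Suc D) * a ^ (k - 1))"
    unfolding root_prob_def by blast
  have "k > 0" using k by simp
  from regular_union[OF G\<^sub>1(1) G\<^sub>2(1) this] obtain V :: "nat set" and E v\<^sub>1 v\<^sub>2 where
    "finite_kgraph k V E" "linear_hypergraph E" "regular_hypergraph (Suc D) V E"
    "v\<^sub>1 \<in> V" "v\<^sub>2 \<in> V" "v\<^sub>1 \<noteq> v\<^sub>2"
    "prob_uncovered E v\<^sub>1 = prob_uncovered E\<^sub>1 r\<^sub>1" "prob_uncovered E v\<^sub>2 = prob_uncovered E\<^sub>2 r\<^sub>2"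
    by blast
  moreover from this bounds have "prob_uncovered E v\<^sub>1 > 1 - (1 + \<epsilon>) / real (Suc D) ^ (k - 2)"
    "prob_uncovered E v\<^sub>2 < (1 + \<epsilon>) / (real (Suc D) + 1)"
    by (simp_all only: G\<^sub>1(2) G\<^sub>2(2))
  moreover have "real (Suc D) > d\<^sub>0" using D by simp
  ultimately show ?thesis by blast
qed

end
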